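(* Let $n\ge 1$, $\mathbf{x}\in[0,1]^n$, $H\in\mathbb{R}^{n\times n}$, $\gamma>0$, $\delta=\epsilon\,\mathbf{1}^\top\mathbf{x}>0$, and let $C\in\mathbb{R}^{n\times n}$ be a cost matrix with nonnegative entries and $C_{ij}=0\Leftrightarrow i=j$. Let $\Pi^\star$ be the solution of the primal problem $$\min_{\Pi\in\mathbb{R}^{n\times n},\,\Pi\ge0}\ \langle\Pi,H\rangle+\gamma\sum_{i=1}^n\sum_{j=1}^n\Pi_{ij}\log\Pi_{ij}\quad\text{subject to}\quad \Pi\mathbf{1}=\mathbf{x},\ \ \langle\Pi,C\rangle\le\delta,$$ and let $\lambda^\star$ be a solution of its dual problem $$\max_{\lambda\ge0}\ -\lambda\delta+\gamma\sum_{i:\,x_i>0}x_i\log x_i-\gamma\sum_{i=1}^n x_i\log\sum_{j=1}^n\exp\left(-\frac{H_{ij}+\lambda C_{ij}}{\gamma}\right).$$ Then for all $1\le i,j\le n$, $$\Pi^\star_{ij}=x_i\cdot\frac{\exp\left(-\frac{H_{ij}+\lambda^\star C_{ij}}{\gamma}\right)}{\sum_{k=1}^n\exp\left(-\frac{H_{ik}+\lambda^\star C_{ik}}{\gamma}\right)}.$$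
   Context: $\mathbf{1}\in\mathbb{R}^n$ is the all-ones vector; $\Pi\ge0$ is entrywise; $\langle A,B\rangle=\sum_{i,j}A_{ij}B_{ij}$; the convention $0\log0=0$ is used. $\epsilon>0$ is a scalar. *)

theory Defs
  imports "HOL-Analysis.Analysis"
begin

(* Matrices are indexed row-first, P $ i $ j.  The inner product P \<bullet> H on real^'n^'n is the
   sum over i and j of P $ i $ j * H $ i $ j, and 1 :: real^'n is the all-ones vector.
   The factor in front of ln makes 0 * ln 0 = 0. *)

definition primal_objective :: "real^'n^'n \<Rightarrow> real \<Rightarrow> real^'n^'n \<Rightarrow> real" where
  "primal_objective H \<gamma> P =
     P \<bullet> H + \<gamma> * (\<Sum>i\<in>UNIV. \<Sum>j\<in>UNIV. P $ i $ j * ln (P $ i $ j))"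

definition primal_feasible :: "real^'n \<Rightarrow> real^'n^'n \<Rightarrow> real \<Rightarrow> real^'n^'n \<Rightarrow> bool" where
  "primal_feasible x C \<delta> P \<longleftrightarrow>
     (\<forall>i j. P $ i $ j \<ge> 0) \<and> P *v 1 = x \<and> P \<bullet> C \<le> \<delta>"

definition dual_objective ::
  "real^'n \<Rightarrow> real^'n^'n \<Rightarrow> real^'n^'n \<Rightarrow> real \<Rightarrow> real \<Rightarrow> real \<Rightarrow> real" where
  "dual_objective x H C \<gamma> \<delta> l =
     - l * \<delta> + \<gamma> * (\<Sum>i | x $ i > 0. x $ i * ln (x $ i))
     - \<gamma> * (\<Sum>i\<in>UNIV. x $ i *
           ln (\<Sum>j\<in>UNIV. exp (- ((H $ i $ j + l * C $ i $ j) / \<gamma>))))"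

end

theory Submission
  imports Defs
begin

text \<open>The Gibbs plan \<open>Q\<close> at the dual optimum \<open>l\<close> satisfies \<open>D' l = Q \<bullet> C - \<delta>\<close> for the dual objective
  \<open>D\<close>, so the first-order conditions for \<open>D\<close> on \<open>[0, \<infinity>)\<close> say exactly that \<open>Q\<close> is primal feasible
  and that \<open>l * (Q \<bullet> C - \<delta>) = 0\<close>.  The Lagrangian of a plan \<open>P\<close> with the right row sums exceeds that
  of \<open>Q\<close> by \<open>\<gamma>\<close> times the relative entropy of \<open>P\<close> with respect to \<open>Q\<close>.  By complementary
  slackness the primal objective of a feasible \<open>P\<close> exceeds that of \<open>Q\<close> by at least as much, so a
  primal optimum has relative entropy zero and equals \<open>Q\<close>.\<close>

definition gibbs_partition :: "real^'n^'n \<Rightarrow> real^'n^'n \<Rightarrow> real \<Rightarrow> real \<Rightarrow> 'n \<Rightarrow> real" where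
  "gibbs_partition H C \<gamma> l i = (\<Sum>k\<in>UNIV. exp (- ((H $ i $ k + l * C $ i $ k) / \<gamma>)))"

definition gibbs_plan :: "real^'n \<Rightarrow> real^'n^'n \<Rightarrow> real^'n^'n \<Rightarrow> real \<Rightarrow> real \<Rightarrow> real^'n^'n" where
  "gibbs_plan x H C \<gamma> l =
     (\<chi> i j. x $ i * (exp (- ((H $ i $ j + l * C $ i $ j) / \<gamma>)) / gibbs_partition H C \<gamma> l i))"

text \<open>Generalized Kullback-Leibler divergence. The correction \<open>- P + Q\<close> makes
  each summand nonnegative on its own, and it cancels in every row where the two row sums
  agree.\<close>

definition relative_entropy :: "real^'n^'n \<Rightarrow> real^'n^'n \<Rightarrow> real" where
  "relative_entropy P Q =
     (\<Sum>i\<in>UNIV. \<Sum>j\<in>UNIV. P $ i $ j * ln (P $ i $ j) - P $ i $ j * ln (Q $ i $ j)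
        - P $ i $ j + Q $ i $ j)"

text \<open>For \<open>p > 0\<close> the term is \<open>p * (u - 1 - ln u)\<close> with
  \<open>u = q / p\<close>, and \<open>ln u\<close> is at most \<open>u - 1\<close> with equality
  only at \<open>u = 1\<close>. The third assumption is absolute continuity: as
  \<open>ln 0 = 0\<close>, the term at \<open>q = 0\<close> is \<open>p * ln p - p\<close>, which is
  negative for \<open>0 < p < exp 1\<close>.\<close>

lemma
  fixes p q :: real
  assumes "0 \<le> p" "0 \<le> q" "q = 0 \<Longrightarrow> p = 0"
  shows relative_entropy_term_nonneg: "0 \<le> p * ln p - p * ln q - p + q"
    and relative_entropy_term_eq_0: "p * ln p - p * ln q - p + q = 0 \<Longrightarrow> p = q"
proof -
  have "0 \<le> p * ln p - p * ln q - p + q \<and> (p * ln p - p * ln q - p + q = 0 \<longrightarrow> p = q)"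
  proof (cases "p = 0")
    case True
    then show ?thesis using assms by simp
  next
    case False
    with assms have p: "p > 0" and q: "q > 0" by fastforce+
    have eq: "p * ln p - p * ln q - p + q = p * (q / p - 1 - ln (q / p))"
      using p q by (simp add: ln_div field_simps)
    have "ln (q / p) \<le> q / p - 1"
      using p q by (intro ln_le_minus_one) simp
    moreover have "p = q" if "ln (q / p) = q / p - 1"
      using ln_eq_minus_one[OF _ that] p q by simp
    ultimately show ?thesis using p unfolding eq by auto
  qed
  then show "0 \<le> p * ln p - p * ln q - p + q"
    and "p * ln p - p * ln q - p + q = 0 \<Longrightarrow> p = q" by auto
qed

lemma relative_entropy_self [simp]: "relative_entropy P P = 0"
  by (simp add: relative_entropy_def)

lemma relative_entropy_le_0_imp_eq:
  fixes P Q :: "real^'n^'n"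
  assumes P: "\<And>i j. 0 \<le> P $ i $ j" and Q: "\<And>i j. 0 \<le> Q $ i $ j"
    and ac: "\<And>i j. Q $ i $ j = 0 \<Longrightarrow> P $ i $ j = 0"
    and le: "relative_entropy P Q \<le> 0"
  shows "P = Q"
proof -
  define t where "t i j = P $ i $ j * ln (P $ i $ j) - P $ i $ j * ln (Q $ i $ j)
    - P $ i $ j + Q $ i $ j" for i j
  have t: "0 \<le> t i j" for i j
    unfolding t_def using P Q ac by (rule relative_entropy_term_nonneg)
  have "(\<Sum>i\<in>UNIV. \<Sum>j\<in>UNIV. t i j) = 0"
    using le t by (intro antisym) (simp_all add: relative_entropy_def t_def sum_nonneg)
  then have "t i j = 0" for i j
    using t by (simp add: sum_nonneg_eq_0_iff sum_nonneg)
  then show ?thesis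
    using P Q ac by (auto simp: vec_eq_iff t_def intro: relative_entropy_term_eq_0)
qed

lemma matrix_inner_sum:
  fixes A B :: "real^'n^'n"
  shows "A \<bullet> B = (\<Sum>i\<in>UNIV. \<Sum>j\<in>UNIV. A $ i $ j * B $ i $ j)"
  by (simp add: inner_vec_def)

lemma mult_one_vec_nth: "((P :: real^'n^'n) *v 1) $ i = (\<Sum>j\<in>UNIV. P $ i $ j)"
  by (simp add: matrix_vector_mult_def)

lemma gibbs_partition_pos: "gibbs_partition H C \<gamma> l i > 0"
  unfolding gibbs_partition_def by (intro sum_pos) auto

lemma gibbs_plan_nonneg: "0 \<le> x $ i \<Longrightarrow> 0 \<le> gibbs_plan x H C \<gamma> l $ i $ j"
  by (simp add: gibbs_plan_def gibbs_partition_pos less_imp_le)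

lemma gibbs_plan_eq_0_iff: "gibbs_plan x H C \<gamma> l $ i $ j = 0 \<longleftrightarrow> x $ i = 0"
  using gibbs_partition_pos[of H C \<gamma> l i] by (simp add: gibbs_plan_def)

lemma gibbs_plan_row_sum: "gibbs_plan x H C \<gamma> l *v 1 = x"
proof -
  have "(\<Sum>j\<in>UNIV. gibbs_plan x H C \<gamma> l $ i $ j) = x $ i" for i
    using gibbs_partition_pos[of H C \<gamma> l i]
    by (simp add: gibbs_plan_def sum_distrib_left[symmetric] sum_divide_distrib[symmetric]
        gibbs_partition_def[symmetric])
  then show ?thesis by (simp add: vec_eq_iff mult_one_vec_nth)
qed

lemma ln_gibbs_plan:
  assumes "x $ i > 0"
  shows "ln (gibbs_plan x H C \<gamma> l $ i $ j) =
    ln (x $ i) - ln (gibbs_partition H C \<gamma> l i) - (H $ i $ j + l * C $ i $ j) / \<gamma>"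
  using assms gibbs_partition_pos[of H C \<gamma> l i]
  by (simp add: gibbs_plan_def ln_mult ln_div)

text \<open>Where \<open>x $ i > 0\<close>, the logarithm of the Gibbs plan is affine in
  \<open>H $ i $ j + l * C $ i $ j\<close>, so the cross term of the relative entropy reproduces the
  linear costs. What remains depends on \<open>R\<close> only through its row sums \<open>x\<close>,
  hence is the same for all plans compared.\<close>

lemma lagrangian_eq_relative_entropy:
  fixes R :: "real^'n^'n"
  assumes "\<gamma> > 0" and R: "\<And>i j. 0 \<le> R $ i $ j" and row: "R *v 1 = x"
  shows "primal_objective H \<gamma> R + l * (R \<bullet> C) =
    \<gamma> * relative_entropy R (gibbs_plan x H C \<gamma> l)
    + \<gamma> * (\<Sum>i\<in>UNIV. x $ i * (ln (x $ i) - ln (gibbs_partition H C \<gamma> l i)))"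
proof -
  let ?Q = "gibbs_plan x H C \<gamma> l" and ?Z = "gibbs_partition H C \<gamma> l"
  have xi: "x $ i = (\<Sum>j\<in>UNIV. R $ i $ j)" for i
    using row mult_one_vec_nth by metis
  have Qi: "(\<Sum>j\<in>UNIV. ?Q $ i $ j) = x $ i" for i
    using gibbs_plan_row_sum mult_one_vec_nth by metis
  have Q_term: "\<gamma> * (R $ i $ j * ln (?Q $ i $ j)) = \<gamma> * (R $ i $ j * (ln (x $ i) - ln (?Z i)))
      - R $ i $ j * H $ i $ j - l * (R $ i $ j * C $ i $ j)" for i j
  proof (cases "x $ i = 0")
    case True
    then have "R $ i $ j = 0"
      using xi[of i] R by (simp add: sum_nonneg_eq_0_iff)
    then show ?thesis by simp
  next
    case False
    then have "x $ i > 0"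
      using xi[of i] R by (simp add: less_le sum_nonneg)
    then show ?thesis
      using \<open>\<gamma> > 0\<close> by (simp add: ln_gibbs_plan field_simps)
  qed
  have "\<gamma> * (\<Sum>j\<in>UNIV. R $ i $ j * ln (R $ i $ j) - R $ i $ j * ln (?Q $ i $ j)
        - R $ i $ j + ?Q $ i $ j) =
      \<gamma> * (\<Sum>j\<in>UNIV. R $ i $ j * ln (R $ i $ j)) + (\<Sum>j\<in>UNIV. R $ i $ j * H $ i $ j)
      + l * (\<Sum>j\<in>UNIV. R $ i $ j * C $ i $ j) - \<gamma> * (x $ i * (ln (x $ i) - ln (?Z i)))" for i
  proof -
    have "\<gamma> * (\<Sum>j\<in>UNIV. R $ i $ j * ln (?Q $ i $ j)) =
        (\<Sum>j\<in>UNIV. \<gamma> * (R $ i $ j * ln (?Q $ i $ j)))"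
      by (rule sum_distrib_left)
    also have "\<dots> = \<gamma> * (x $ i * (ln (x $ i) - ln (?Z i)))
        - (\<Sum>j\<in>UNIV. R $ i $ j * H $ i $ j) - l * (\<Sum>j\<in>UNIV. R $ i $ j * C $ i $ j)"
      unfolding Q_term
      by (simp add: sum_subtractf sum_distrib_left[symmetric] sum_distrib_right[symmetric] xi[symmetric])
    finally show ?thesis
      by (simp add: sum.distrib sum_subtractf Qi xi[symmetric] right_diff_distrib)
  qed
  then show ?thesis
    unfolding relative_entropy_def primal_objective_def matrix_inner_sum sum_distrib_left[of \<gamma>]
    by (simp add: sum.distrib sum_subtractf sum_distrib_left)
qed

text \<open>The derivative of the log-partition function of row \<open>i\<close> is
  \<open>- 1 / \<gamma>\<close> times the mean of \<open>C $ i $ j\<close> under the Gibbs weights;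
  the factor \<open>- \<gamma> * x $ i\<close> turns this into the cost of row \<open>i\<close> of
  the plan.\<close>

lemma dual_objective_has_derivative:
  fixes x :: "real^'n"
  assumes "\<gamma> > 0"
  shows "(dual_objective x H C \<gamma> \<delta> has_real_derivative gibbs_plan x H C \<gamma> l \<bullet> C - \<delta>) (at l)"
proof -
  have Z: "((\<lambda>l. gibbs_partition H C \<gamma> l i) has_real_derivative
      (\<Sum>j\<in>UNIV. exp (- ((H $ i $ j + l * C $ i $ j) / \<gamma>)) * (- (C $ i $ j / \<gamma>)))) (at l)" for i
    unfolding gibbs_partition_def using assms
    by (auto intro!: derivative_eq_intros sum.cong)
  have "((\<lambda>l. - l * \<delta> + \<gamma> * (\<Sum>i | x $ i > 0. x $ i * ln (x $ i))
      - \<gamma> * (\<Sum>i\<in>UNIV. x $ i * ln (gibbs_partition H C \<gamma> l i))) has_real_derivative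
      - \<delta> - \<gamma> * (\<Sum>i\<in>UNIV. x $ i * ((1 / gibbs_partition H C \<gamma> l i) *
        (\<Sum>j\<in>UNIV. exp (- ((H $ i $ j + l * C $ i $ j) / \<gamma>)) * (- (C $ i $ j / \<gamma>)))))) (at l)"
    by (auto intro!: derivative_eq_intros Z simp: gibbs_partition_pos mult.commute)
  moreover have "- (\<gamma> * (\<Sum>i\<in>UNIV. x $ i * ((1 / gibbs_partition H C \<gamma> l i) *
        (\<Sum>j\<in>UNIV. exp (- ((H $ i $ j + l * C $ i $ j) / \<gamma>)) * (- (C $ i $ j / \<gamma>))))))
      = gibbs_plan x H C \<gamma> l \<bullet> C"
    unfolding matrix_inner_sum sum_distrib_left gibbs_plan_def sum_negf[symmetric] using assms
    by (intro sum.cong) auto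
  then have "- \<delta> - \<gamma> * (\<Sum>i\<in>UNIV. x $ i * ((1 / gibbs_partition H C \<gamma> l i) *
        (\<Sum>j\<in>UNIV. exp (- ((H $ i $ j + l * C $ i $ j) / \<gamma>)) * (- (C $ i $ j / \<gamma>)))))
      = gibbs_plan x H C \<gamma> l \<bullet> C - \<delta>"
    by linarith
  ultimately show ?thesis
    unfolding dual_objective_def gibbs_partition_def by (rule DERIV_cong)
qed

text \<open>A step to the right is always admissible, which excludes \<open>D > 0\<close>; a step to
  the left is admissible only if \<open>l > 0\<close>, which then excludes
  \<open>D < 0\<close>.\<close>

lemma arg_max_nonneg_first_order:
  fixes f :: "real \<Rightarrow> real"
  assumes "is_arg_max f (\<lambda>l. l \<ge> 0) l" and D: "(f has_real_derivative D) (at l)"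
  shows "D \<le> 0" and "l * D = 0"
proof -
  have l: "l \<ge> 0" and max: "\<And>y. y \<ge> 0 \<Longrightarrow> f y \<le> f l"
    using assms(1) by (auto simp: is_arg_max_def not_less)
  show "D \<le> 0"
  proof (rule ccontr)
    assume "\<not> D \<le> 0"
    then obtain d where "d > 0" and d: "\<And>h. 0 < h \<Longrightarrow> h < d \<Longrightarrow> f l < f (l + h)"
      using DERIV_pos_inc_right[OF D] by auto
    have "f l < f (l + d / 2)"
      using \<open>d > 0\<close> by (intro d) auto
    then show False
      using \<open>d > 0\<close> max[of "l + d / 2"] l by simp
  qed
  moreover have "\<not> D < 0" if "l > 0"
  proof
    assume "D < 0"
    then obtain d where "d > 0" and d: "\<And>h. 0 < h \<Longrightarrow> h < d \<Longrightarrow> f l < f (l - h)"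
      using DERIV_neg_dec_left[OF D] by auto
    \<comment> \<open>Capping by \<open>l\<close> keeps \<open>l - h\<close> in the domain; halving
      \<open>d\<close> keeps \<open>h\<close> strictly below it.\<close>
    define h where "h = min (d / 2) l"
    have "0 < h" "h < d" "h \<le> l"
      using \<open>d > 0\<close> that by (auto simp: h_def)
    then show False
      using d[of h] max[of "l - h"] by simp
  qed
  ultimately show "l * D = 0"
    using l by force
qed

theorem proposition7:
  fixes x :: "real^'n" and H C P :: "real^'n^'n" and \<gamma> \<epsilon> \<delta> l :: real
  assumes "\<forall>i. x $ i \<in> {0..1}"
    and "\<gamma> > 0"
    and "\<epsilon> > 0"
    and "\<delta> = \<epsilon> * (1 \<bullet> x)"
    and "\<delta> > 0"
    and "\<forall>i j. C $ i $ j \<ge> 0"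
    and "\<forall>i j. C $ i $ j = 0 \<longleftrightarrow> i = j"
    and "is_arg_min (primal_objective H \<gamma>) (primal_feasible x C \<delta>) P"
    and "is_arg_max (dual_objective x H C \<gamma> \<delta>) (\<lambda>l. l \<ge> 0) l"
  shows "\<forall>i j. P $ i $ j =
    x $ i * (exp (- ((H $ i $ j + l * C $ i $ j) / \<gamma>)) /
             (\<Sum>k\<in>UNIV. exp (- ((H $ i $ k + l * C $ i $ k) / \<gamma>))))"
proof -
  let ?Q = "gibbs_plan x H C \<gamma> l"
  have \<gamma>: "\<gamma> > 0" by fact
  have l: "l \<ge> 0"
    using assms(9) by (simp add: is_arg_max_def)
  have Q_cost: "?Q \<bullet> C - \<delta> \<le> 0" and slack: "l * (?Q \<bullet> C - \<delta>) = 0"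
    using arg_max_nonneg_first_order[OF assms(9) dual_objective_has_derivative[OF \<gamma>]] by auto
  have Q_nonneg: "0 \<le> ?Q $ i $ j" for i j
    using assms(1) by (simp add: gibbs_plan_nonneg)
  have P_nonneg: "0 \<le> P $ i $ j" and P_row: "P *v 1 = x" and P_cost: "P \<bullet> C \<le> \<delta>" for i j
    using assms(8) by (auto simp: is_arg_min_def primal_feasible_def)
  have "primal_feasible x C \<delta> ?Q"
    using Q_nonneg Q_cost by (simp add: primal_feasible_def gibbs_plan_row_sum)
  then have "primal_objective H \<gamma> P \<le> primal_objective H \<gamma> ?Q"
    using assms(8) by (auto simp: is_arg_min_def not_less)
  \<comment> \<open>The identity is applied to \<open>P\<close> and to \<open>?Q\<close>, whose
    relative entropy to itself is 0; eliminating the common row term leaves this.\<close>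
  moreover have "primal_objective H \<gamma> P + l * (P \<bullet> C) =
      \<gamma> * relative_entropy P ?Q + (primal_objective H \<gamma> ?Q + l * (?Q \<bullet> C))"
    unfolding lagrangian_eq_relative_entropy[OF \<gamma> P_nonneg P_row]
      lagrangian_eq_relative_entropy[OF \<gamma> Q_nonneg gibbs_plan_row_sum] by simp
  \<comment> \<open>By complementary slackness the right-hand side equals
    \<open>l * \<delta>\<close>.\<close>
  moreover have "l * (P \<bullet> C) \<le> l * (?Q \<bullet> C)"
    using mult_left_mono[OF P_cost l] slack by auto
  ultimately have "\<gamma> * relative_entropy P ?Q \<le> 0" by linarith
  then have "relative_entropy P ?Q \<le> 0"
    using \<gamma> by (simp add: mult_le_0_iff)
  \<comment> \<open>Absolute continuity: a zero of \<open>?Q\<close> forces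
    \<open>x $ i = 0\<close>, and then row \<open>i\<close> of \<open>P\<close> has sum 0.\<close>
  moreover have "P $ i $ j = 0" if "?Q $ i $ j = 0" for i j
  proof -
    have "(\<Sum>j\<in>UNIV. P $ i $ j) = 0"
      using that P_row by (metis gibbs_plan_eq_0_iff mult_one_vec_nth)
    then show ?thesis
      using P_nonneg by (simp add: sum_nonneg_eq_0_iff)
  qed
  ultimately have "P = ?Q"
    using P_nonneg Q_nonneg by (intro relative_entropy_le_0_imp_eq)
  then show ?thesis
    by (simp add: gibbs_plan_def gibbs_partition_def)
qed

end
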